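(* Consider Alpern's Caching Game $G(2,2,n,h)$ with $n\ge 1$ holes and digging limit $h$. If $\frac{n+1}{2}\le h\le n$, then the value of the game is $v(2,2,n,h)=\frac{\lfloor h\rfloor}{n}$. Moreover, for all $n\ge1$ and $h>0$, $v(2,2,n,h)\le \frac{\lfloor h\rfloor}{n}$; this bound is provided by the hiding strategy of putting both nuts into the same uniformly random hole at depth $1$.
   Context: Alpern's Caching Game $G(2,2,n,h)$ ($n\ge 1$ integer, $h>0$ real): the hider places each of $2$ nuts into one of $n$ holes at a positive depth, so that the sum, over the non-empty holes, of the depth of the deepest nut in the hole is at most $1$ (a placement). The searcher observes nothing about the placement and digs in the holes (switching between holes at will, or digging several in parallel), with total digging at most $h$. A nut is found once its hole has been dug at least to the depth of the nut. The searching strategy is adaptive: the searcher continuously observes what he has found and where. The searcher wins if he finds both nuts; otherwise the hider wins. Both players may use mixed strategies (only those for which winning probabilities are defined). The value $v(2,2,n,h)$ is the value of this zero-sum game with payoff the winning probability of the searcher, i.e. the common value of $\sup$ over searching strategies of $\inf$ over placements, and $\inf$ over hiding strategies of $\sup$ over pure searching strategies. *)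

theory Defs
  imports "HOL-Probability.Probability" "HOL-Library.Multiset"
begin

text \<open>A nut is given by its hole and its depth. A placement lists the two nuts in some order,
  but the nuts are indistinguishable: all that the searcher ever observes is a multiset of nuts.\<close>

type_synonym nut = "nat \<times> real"
type_synonym placement = "nut \<times> nut"

definition nuts :: "placement \<Rightarrow> nut multiset"
  where "nuts P = {#fst P, snd P#}"

definition placements :: "nat \<Rightarrow> placement set" where
  "placements n = {P.
     (\<forall>(i, x) \<in> set_mset (nuts P). i < n \<and> 0 < x) \<and>
     (\<Sum>i \<in> fst ` set_mset (nuts P). Max {x. (i, x) \<in> set_mset (nuts P)}) \<le> 1}"

text \<open>Digging is described by the depths \<open>c t k\<close> dug in the holes \<open>k < n\<close> up to time \<open>t \<in> [0, h]\<close>.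
  The total digging speed is at most 1, shared arbitrarily among the holes, so the total digging
  is at most \<open>h\<close>; idling, hence also stopping early, is allowed.\<close>

type_synonym digging = "real \<Rightarrow> nat \<Rightarrow> real"

definition digging_path :: "nat \<Rightarrow> real \<Rightarrow> digging \<Rightarrow> bool" where
  "digging_path n h c \<longleftrightarrow>
     (\<forall>k<n. c 0 k = 0) \<and>
     (\<forall>s t. 0 \<le> s \<and> s \<le> t \<and> t \<le> h \<longrightarrow>
        (\<forall>k<n. c s k \<le> c t k) \<and> (\<Sum>k<n. c t k - c s k) \<le> t - s)"

definition found :: "placement \<Rightarrow> (nat \<Rightarrow> real) \<Rightarrow> nut multiset"
  where "found P d = filter_mset (\<lambda>(i, x). x \<le> d i) (nuts P)"

text \<open>A pure (adaptive) searching strategy maps each placement to the digging it results in.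
  That the searcher only knows his past finds is expressed by non-anticipation: as long as two
  placements have produced the same finds (in the same holes, at the same depths and times), the
  digging is the same. As depths are positive and digging is continuous, this means: one
  digging path until the first find, continued according to the hole and the depth of that find.\<close>

type_synonym strategy = "placement \<Rightarrow> digging"

definition searching_strategies :: "nat \<Rightarrow> real \<Rightarrow> strategy set" where
  "searching_strategies n h = {\<sigma>.
     (\<forall>P \<in> placements n. digging_path n h (\<sigma> P)) \<and>
     (\<forall>P \<in> placements n. \<forall>Q \<in> placements n. \<forall>t \<in> {0..h}.
        (\<forall>s \<in> {0..<t}. found P (\<sigma> P s) = found Q (\<sigma> Q s)) \<longrightarrow>
        (\<forall>k<n. \<sigma> P t k = \<sigma> Q t k))}"

definition searcher_wins :: "real \<Rightarrow> strategy \<Rightarrow> placement \<Rightarrow> bool"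
  where "searcher_wins h \<sigma> P \<longleftrightarrow> found P (\<sigma> P h) = nuts P"

text \<open>Mixed strategies of the searcher are arbitrary probability spaces of pure strategies
  in which winning against any given placement is an event.\<close>

definition mixed_searching_strategies :: "nat \<Rightarrow> real \<Rightarrow> strategy measure set" where
  "mixed_searching_strategies n h = {M. prob_space M \<and> space M \<subseteq> searching_strategies n h \<and>
     (\<forall>P \<in> placements n. {\<sigma> \<in> space M. searcher_wins h \<sigma> P} \<in> sets M)}"

text \<open>Mixed strategies of the hider are probability measures on the placements that are defined at
  least on the Borel sets. Larger sigma-algebras are allowed, so that e.g. finitely
  supported strategies give a winning probability to every pure searching strategy.\<close>

definition hiding_strategies :: "nat \<Rightarrow> placement measure set" where
  "hiding_strategies n = {H. prob_space H \<and> space H = placements n \<and>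
     sets (restrict_space borel (placements n)) \<subseteq> sets H}"

definition winning_set :: "nat \<Rightarrow> real \<Rightarrow> strategy \<Rightarrow> placement set"
  where "winning_set n h \<sigma> = {P \<in> placements n. searcher_wins h \<sigma> P}"

definition lower_value :: "nat \<Rightarrow> real \<Rightarrow> real" where
  "lower_value n h = (SUP M \<in> mixed_searching_strategies n h. INF P \<in> placements n.
     measure M {\<sigma> \<in> space M. searcher_wins h \<sigma> P})"

text \<open>The supremum is over the pure strategies whose winning probability against \<open>H\<close> is
  defined: a continuation depending non-measurably on the first find is meaningless against a
  diffuse \<open>H\<close>.\<close>

definition upper_value :: "nat \<Rightarrow> real \<Rightarrow> real" where
  "upper_value n h = (INF H \<in> hiding_strategies n.
     SUP \<sigma> \<in> {\<sigma> \<in> searching_strategies n h. winning_set n h \<sigma> \<in> sets H}.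
       measure H (winning_set n h \<sigma>))"

definition has_value :: "nat \<Rightarrow> real \<Rightarrow> real \<Rightarrow> bool"
  where "has_value n h v \<longleftrightarrow> lower_value n h = v \<and> upper_value n h = v"

definition uniform_bottom_hiding :: "nat \<Rightarrow> placement measure" where
  "uniform_bottom_hiding n =
     distr (uniform_count_measure {..<n}) (count_space (placements n)) (\<lambda>i. ((i, 1), (i, 1)))"

end

theory Submission
  imports Defs "HOL-Combinatorics.Permutations"
begin

text \<open>Upper bound: if both nuts lie at the bottom of one uniformly random hole, a winning searcher
  empties that hole before finding anything, so at most \<open>\<lfloor>h\<rfloor>\<close> of the holes are winning.

  Lower bound: let \<open>k = \<lfloor>h\<rfloor>\<close>. Dig \<open>k\<close> random holes in parallel. When the first nut is found at
  depth \<open>x\<close> in a hole, empty this hole and search down to depth \<open>1 - x\<close> in \<open>k - 1\<close> others,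
  preferring those that are not among the first \<open>k\<close>; this costs \<open>k\<close> in total. As
  \<open>(n + 1) / 2 \<le> h\<close>, either all of the \<open>n - k\<close> untouched holes are covered in this way, or exactly
  one is left and half a unit of digging remains for it. Nuts in one hole are found with
  probability \<open>k / n\<close>. Nuts in two holes are found whenever only the deeper one is in an initial
  hole, or the shallower one is and the other hole is among the \<open>k - 1\<close> chosen ones: these are
  \<open>k (n - 1)\<close> of the \<open>n (n - 1)\<close> pairs of positions.\<close>

section \<open>Placements and digging paths\<close>

lemma nuts_pair [simp]: "nuts ((i, x), (j, y)) = {#(i, x), (j, y)#}"
  by (simp add: nuts_def)

lemma placements_iff:
  "((i, x), (j, y)) \<in> placements n \<longleftrightarrow>
     i < n \<and> j < n \<and> 0 < x \<and> 0 < y \<and> (if i = j then max x y \<le> 1 else x + y \<le> 1)"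
proof (cases "i = j")
  case True
  have "{u. (j, u) = (j, x) \<or> (j, u) = (j, y)} = {x, y}" by auto
  with True show ?thesis by (auto simp: placements_def)
next
  case False
  then have "{u. (i, u) = (i, x) \<or> (i, u) = (j, y)} = {x}"
    "{u. (j, u) = (i, x) \<or> (j, u) = (j, y)} = {y}" by auto
  with False show ?thesis by (auto simp: placements_def)
qed

lemma placements_nutD:
  assumes "P \<in> placements n" "(i, x) \<in># nuts P"
  shows "i < n" "0 < x" "x \<le> 1"
proof -
  obtain a u b v where "P = ((a, u), (b, v))" by (metis surj_pair)
  with assms show "i < n" "0 < x" "x \<le> 1" by (auto simp: placements_iff split: if_splits)
qed

lemma searcher_wins_iff:
  "searcher_wins h \<sigma> P \<longleftrightarrow> (\<forall>(i, x) \<in># nuts P. x \<le> \<sigma> P h i)"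
  by (auto simp: searcher_wins_def found_def filter_mset_eq_conv)

lemma digging_path_increment:
  assumes "digging_path n h c" "0 \<le> s" "s \<le> t" "t \<le> h" "k < n"
  shows "c s k \<le> c t k" "c t k - c s k \<le> t - s"
proof -
  have mono: "\<forall>k<n. c s k \<le> c t k" and le: "(\<Sum>k<n. c t k - c s k) \<le> t - s"
    using assms by (auto simp: digging_path_def)
  show "c s k \<le> c t k" using mono assms by auto
  have "c t k - c s k \<le> (\<Sum>k<n. c t k - c s k)"
    using mono assms by (intro member_le_sum) auto
  with le show "c t k - c s k \<le> t - s" by simp
qed

text \<open>Continuity makes the set of times at which a hole has reached a given depth closed, so
  that there is a first such time.\<close>

lemma digging_path_continuous:
  assumes "digging_path n h c" "k < n"
  shows "continuous_on {0..h} (\<lambda>t. c t k)"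
proof -
  have "dist (c s k) (c t k) \<le> dist s t" if "s \<in> {0..h}" "t \<in> {0..h}" for s t
    using that digging_path_increment[OF assms(1), of s t k]
      digging_path_increment[OF assms(1), of t s k] assms(2)
    by (cases "s \<le> t") (auto simp: dist_real_def)
  then have "1-lipschitz_on {0..h} (\<lambda>t. c t k)" by (intro lipschitz_onI) auto
  then show ?thesis by (rule lipschitz_on_continuous_on)
qed

text \<open>Idling witnesses that the suprema below range over nonempty sets, and its winning
  probability 0 bounds the suprema in \<open>upper_value\<close> from below.\<close>

lemma idle_strategy:
  "(\<lambda>_ _ _. 0) \<in> searching_strategies n h" "P \<in> placements n \<Longrightarrow> \<not> searcher_wins h (\<lambda>_ _ _. 0) P"
proof -
  show "(\<lambda>_ _ _. 0) \<in> searching_strategies n h"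
    by (auto simp: searching_strategies_def digging_path_def)
  assume P: "P \<in> placements n"
  then have "0 < snd (fst P)" by (intro placements_nutD(2)[OF P, of "fst (fst P)"]) (simp add: nuts_def)
  moreover have "fst P \<in># nuts P" by (simp add: nuts_def)
  ultimately show "\<not> searcher_wins h (\<lambda>_ _ _. 0) P"
    by (auto simp: searcher_wins_iff intro!: bexI[of _ "fst P"])
qed

section \<open>Both nuts at the bottom of one hole\<close>

text \<open>Until a hole reaches depth 1 nothing is found, so up to the last moment at which some
  winning hole is completed all these placements see the same digging path.\<close>

lemma card_winning_bottoms_le:
  assumes \<sigma>: "\<sigma> \<in> searching_strategies n h" and h: "h > 0"
  shows "int (card {i. i < n \<and> searcher_wins h \<sigma> ((i, 1), (i, 1))}) \<le> \<lfloor>h\<rfloor>"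
proof (cases "{i. i < n \<and> searcher_wins h \<sigma> ((i, 1), (i, 1))} = {}")
  case True
  then show ?thesis using h by (simp only: card.empty) simp
next
  case False
  define W where "W = {i. i < n \<and> searcher_wins h \<sigma> ((i, 1), (i, 1))}"
  let ?c = "\<lambda>i. \<sigma> ((i, 1), (i, 1))"
  have pl: "((i, 1), (i, 1)) \<in> placements n" if "i < n" for i using that by (simp add: placements_iff)
  have path: "digging_path n h (?c i)" if "i < n" for i
    using \<sigma> pl[OF that] by (auto simp: searching_strategies_def)
  have W: "i < n" "1 \<le> ?c i h i" if "i \<in> W" for i
    using that by (auto simp: W_def searcher_wins_iff)
  \<comment> \<open>\<open>T\<close> is the first moment at which hole \<open>i\<close> reaches
    depth 1, obtained as the minimum of a compact set of times that contains
    \<open>h\<close>.\<close>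
  have "\<exists>T \<in> {0..h}. 1 \<le> ?c i T i \<and> (\<forall>s \<in> {0..<T}. ?c i s i < 1)" if "i \<in> W" for i
  proof -
    let ?A = "{t \<in> {0..h}. ?c i t i \<in> {1..}}"
    have "closed ?A"
      using continuous_closed_preimage[OF digging_path_continuous[OF path], of i i "{1..}"] W[OF that]
      by (simp add: vimage_def Int_def)
    then have "compact ({0..h} \<inter> ?A)" by (intro compact_Int_closed) auto
    moreover have "h \<in> {0..h} \<inter> ?A" using W[OF that] h by auto
    ultimately obtain T where T: "T \<in> {0..h} \<inter> ?A" "\<forall>t \<in> {0..h} \<inter> ?A. T \<le> t"
      using compact_attains_inf[of "{0..h} \<inter> ?A"] by blast
    then show ?thesis by (intro bexI[of _ T]) (auto, smt (verit) T(2) Int_iff atLeastAtMost_iff atLeast_iff mem_Collect_eq)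
  qed
  then obtain T where T: "\<And>i. i \<in> W \<Longrightarrow> T i \<in> {0..h}" "\<And>i. i \<in> W \<Longrightarrow> 1 \<le> ?c i (T i) i"
    "\<And>i s. i \<in> W \<Longrightarrow> s \<in> {0..<T i} \<Longrightarrow> ?c i s i < 1" by metis
  have fin: "finite W" "W \<noteq> {}" using False by (auto simp: W_def)
  have "Max (T ` W) \<in> T ` W" using fin by (intro Max_in) auto
  then obtain m where "m \<in> W" "Max (T ` W) = T m" by auto
  then have m: "m \<in> W" "\<And>i. i \<in> W \<Longrightarrow> T i \<le> T m"
    using Max_ge[of "T ` W"] fin by auto
  \<comment> \<open>The hole \<open>m\<close> is the winning hole completed last. Before
    \<open>T i\<close> neither of the placements \<open>i\<close> and \<open>m\<close> has produced
    a find, and non-anticipation compares finds strictly before a time only, so the two paths still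
    agree at \<open>T i\<close> itself. Hence the single path \<open>?c m\<close> empties every hole
    of \<open>W\<close>.\<close>
  have "1 \<le> ?c m h i" if i: "i \<in> W" for i
  proof -
    have "found ((i, 1), (i, 1)) (?c i s) = found ((m, 1), (m, 1)) (?c m s)" if "s \<in> {0..<T i}" for s
      using T(3)[OF i, of s] T(3)[OF m(1), of s] m(2)[OF i] that by (simp add: found_def)
    then have "?c i (T i) i = ?c m (T i) i"
      using \<sigma> pl[OF W(1)[OF i]] pl[OF W(1)[OF m(1)]] T(1)[OF i] W(1)[OF i]
      unfolding searching_strategies_def by blast
    then show ?thesis
      using T(1,2)[OF i] digging_path_increment(1)[OF path, of m "T i" h i] W(1)[OF i] W(1)[OF m(1)] by auto
  qed
  then have "real (card W) \<le> (\<Sum>i\<in>W. ?c m h i)"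
    using sum_bounded_below[of W 1 "?c m h"] by simp
  also have "\<dots> \<le> (\<Sum>i<n. ?c m h i - ?c m 0 i)"
  proof -
    have zero: "?c m 0 i = 0" if "i < n" for i
      using path[OF W(1)[OF m(1)]] that by (auto simp: digging_path_def)
    have "0 \<le> ?c m h i - ?c m 0 i" if "i < n" for i
      using digging_path_increment(1)[OF path[OF W(1)[OF m(1)]], of 0 h i] that h by simp
    then have "(\<Sum>i\<in>W. ?c m h i - ?c m 0 i) \<le> (\<Sum>i<n. ?c m h i - ?c m 0 i)"
      using W(1) by (intro sum_mono2) auto
    moreover have "(\<Sum>i\<in>W. ?c m h i - ?c m 0 i) = (\<Sum>i\<in>W. ?c m h i)"
      using zero W(1) by (intro sum.cong) auto
    ultimately show ?thesis by simp
  qed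
  also have "\<dots> \<le> h - 0" using path[OF W(1)[OF m(1)]] h unfolding digging_path_def by (metis less_imp_le order.refl)
  finally have "real (card W) \<le> h" by simp
  then show ?thesis unfolding W_def by (simp add: le_floor_iff)
qed

lemma uniform_bottom_hiding_in:
  assumes "n \<ge> 1"
  shows "uniform_bottom_hiding n \<in> hiding_strategies n"
proof -
  have "prob_space (uniform_bottom_hiding n)"
    unfolding uniform_bottom_hiding_def using assms
    by (intro prob_space.prob_space_distr prob_space_uniform_count_measure)
      (auto simp: measurable_def placements_iff lessThan_empty_iff sets_uniform_count_measure space_uniform_count_measure)
  then show ?thesis
    by (auto simp: hiding_strategies_def uniform_bottom_hiding_def sets_restrict_space)
qed

lemma measure_uniform_bottom_hiding:
  assumes "n \<ge> 1" "A \<subseteq> placements n"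
  shows "measure (uniform_bottom_hiding n) A = card {i. i < n \<and> ((i, 1), (i, 1)) \<in> A} / n"
proof -
  have "measure (uniform_bottom_hiding n) A
    = measure (uniform_count_measure {..<n}) ((\<lambda>i. ((i, 1), (i, 1))) -` A \<inter> {..<n})"
    unfolding uniform_bottom_hiding_def using assms
    by (subst measure_distr)
      (auto simp: measurable_def placements_iff sets_uniform_count_measure space_uniform_count_measure)
  also have "\<dots> = card {i. i < n \<and> ((i, 1), (i, 1)) \<in> A} / n"
    by (subst measure_uniform_count_measure) (auto intro!: arg_cong[where f = card])
  finally show ?thesis .
qed

text \<open>This hiding strategy lives on the full power set of the placements, so every pure
  strategy has a winning probability against it.\<close>

lemma uniform_bottom_hiding_bound:
  assumes "n \<ge> 1" "h > 0" and \<sigma>: "\<sigma> \<in> searching_strategies n h"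
  shows "winning_set n h \<sigma> \<in> sets (uniform_bottom_hiding n)"
    and "measure (uniform_bottom_hiding n) (winning_set n h \<sigma>) \<le> \<lfloor>h\<rfloor> / n"
proof -
  show "winning_set n h \<sigma> \<in> sets (uniform_bottom_hiding n)"
    by (auto simp: uniform_bottom_hiding_def winning_set_def)
  have "{i. i < n \<and> ((i, 1), (i, 1)) \<in> winning_set n h \<sigma>} = {i. i < n \<and> searcher_wins h \<sigma> ((i, 1), (i, 1))}"
    by (auto simp: winning_set_def placements_iff)
  then have "measure (uniform_bottom_hiding n) (winning_set n h \<sigma>)
      = card {i. i < n \<and> searcher_wins h \<sigma> ((i, 1), (i, 1))} / n"
    using assms by (subst measure_uniform_bottom_hiding) (auto simp: winning_set_def)
  also have "\<dots> \<le> \<lfloor>h\<rfloor> / n"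
    using card_winning_bottoms_le[OF \<sigma> \<open>h > 0\<close>] by (intro divide_right_mono) linarith+
  finally show "measure (uniform_bottom_hiding n) (winning_set n h \<sigma>) \<le> \<lfloor>h\<rfloor> / n" .
qed

section \<open>Bounds on the two values from particular strategies\<close>

lemma SUP_winning_ge:
  assumes H: "H \<in> hiding_strategies n" and \<sigma>: "\<sigma> \<in> searching_strategies n h"
    "winning_set n h \<sigma> \<in> sets H"
  shows "measure H (winning_set n h \<sigma>) \<le>
    (SUP \<sigma> \<in> {\<sigma> \<in> searching_strategies n h. winning_set n h \<sigma> \<in> sets H}. measure H (winning_set n h \<sigma>))"
proof -
  interpret prob_space H using H by (simp add: hiding_strategies_def)
  show ?thesis using \<sigma> by (intro cSUP_upper bdd_aboveI[of _ 1]) auto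
qed

lemma upper_value_le:
  assumes "n \<ge> 1" "h > 0"
  shows "upper_value n h \<le> \<lfloor>h\<rfloor> / n"
  unfolding upper_value_def
proof (rule cINF_lower2[OF _ uniform_bottom_hiding_in[OF \<open>n \<ge> 1\<close>]])
  show "bdd_below ((\<lambda>H. SUP \<sigma> \<in> {\<sigma> \<in> searching_strategies n h. winning_set n h \<sigma> \<in> sets H}.
      measure H (winning_set n h \<sigma>)) ` hiding_strategies n)"
  proof (rule bdd_belowI2[of _ 0])
    fix H assume H: "H \<in> hiding_strategies n"
    have "winning_set n h (\<lambda>_ _ _. 0) = {}"
      using idle_strategy(2) by (auto simp: winning_set_def)
    then show "0 \<le> (SUP \<sigma> \<in> {\<sigma> \<in> searching_strategies n h. winning_set n h \<sigma> \<in> sets H}.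
      measure H (winning_set n h \<sigma>))"
      using SUP_winning_ge[OF H idle_strategy(1)[of n h]] by simp
  qed
  show "(SUP \<sigma> \<in> {\<sigma> \<in> searching_strategies n h. winning_set n h \<sigma> \<in> sets (uniform_bottom_hiding n)}.
      measure (uniform_bottom_hiding n) (winning_set n h \<sigma>)) \<le> \<lfloor>h\<rfloor> / n"
    using uniform_bottom_hiding_bound[OF assms] idle_strategy(1)[of n h]
    by (intro cSUP_least) auto
qed

text \<open>A strategy is weighted by the number of its parameters, so \<open>f\<close> may fail to
  be injective. All subsets of the image are events, which makes the measurability required of mixed
  strategies automatic.\<close>

definition finite_mixture :: "'a set \<Rightarrow> ('a \<Rightarrow> strategy) \<Rightarrow> strategy measure"
  where "finite_mixture \<Omega> f = distr (uniform_count_measure \<Omega>) (count_space (f ` \<Omega>)) f"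

lemma finite_mixture:
  assumes "finite \<Omega>" "\<Omega> \<noteq> {}" "f ` \<Omega> \<subseteq> searching_strategies n h"
  shows "finite_mixture \<Omega> f \<in> mixed_searching_strategies n h"
    and "measure (finite_mixture \<Omega> f) {\<sigma> \<in> space (finite_mixture \<Omega> f). Q \<sigma>}
      = card {\<omega> \<in> \<Omega>. Q (f \<omega>)} / card \<Omega>"
proof -
  have meas: "f \<in> measurable (uniform_count_measure \<Omega>) (count_space (f ` \<Omega>))"
    by (auto simp: measurable_def sets_uniform_count_measure space_uniform_count_measure)
  have "prob_space (finite_mixture \<Omega> f)"
    unfolding finite_mixture_def using assms meas
    by (intro prob_space.prob_space_distr prob_space_uniform_count_measure) auto
  then show "finite_mixture \<Omega> f \<in> mixed_searching_strategies n h"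
    using assms by (auto simp: mixed_searching_strategies_def finite_mixture_def)
  have "measure (finite_mixture \<Omega> f) {\<sigma> \<in> space (finite_mixture \<Omega> f). Q \<sigma>}
    = measure (uniform_count_measure \<Omega>) (f -` {\<sigma> \<in> f ` \<Omega>. Q \<sigma>} \<inter> \<Omega>)"
    unfolding finite_mixture_def using meas
    by (subst measure_distr) (auto simp: space_uniform_count_measure)
  also have "\<dots> = card {\<omega> \<in> \<Omega>. Q (f \<omega>)} / card \<Omega>"
    using assms by (subst measure_uniform_count_measure) (auto intro!: arg_cong[where f = card])
  finally show "measure (finite_mixture \<Omega> f) {\<sigma> \<in> space (finite_mixture \<Omega> f). Q \<sigma>}
      = card {\<omega> \<in> \<Omega>. Q (f \<omega>)} / card \<Omega>" .
qed

text \<open>The infimum is at most the average over the \<open>n\<close> bottom placements.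
  Exchanging the sum with the expectation over \<open>\<sigma>\<close> leaves the number of bottom
  placements beaten by one pure strategy.\<close>

lemma INF_winning_le:
  assumes "n \<ge> 1" "h > 0" and M: "M \<in> mixed_searching_strategies n h"
  shows "(INF P \<in> placements n. measure M {\<sigma> \<in> space M. searcher_wins h \<sigma> P}) \<le> \<lfloor>h\<rfloor> / n"
proof -
  interpret prob_space M using M by (simp add: mixed_searching_strategies_def)
  let ?P = "\<lambda>i. ((i, 1), (i, 1))"
  let ?A = "\<lambda>i. {\<sigma> \<in> space M. searcher_wins h \<sigma> (?P i)}"
  let ?I = "INF P \<in> placements n. measure M {\<sigma> \<in> space M. searcher_wins h \<sigma> P}"
  have A: "?A i \<in> sets M" if "i < n" for i
    using M that by (auto simp: mixed_searching_strategies_def placements_iff)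
  have "?I \<le> measure M (?A i)" if "i < n" for i
    using that by (intro cINF_lower bdd_belowI2[of _ 0]) (auto simp: placements_iff)
  then have "n * ?I \<le> (\<Sum>i<n. measure M (?A i))"
    using sum_bounded_below[of "{..<n}" ?I "\<lambda>i. measure M (?A i)"] by simp
  also have "\<dots> = (\<integral>\<sigma>. (\<Sum>i<n. indicator (?A i) \<sigma>) \<partial>M)"
    using A by (subst Bochner_Integration.integral_sum) (auto simp: emeasure_eq_measure)
  also have "\<dots> \<le> (\<integral>\<sigma>. \<lfloor>h\<rfloor> \<partial>M)"
  proof (rule integral_mono)
    fix \<sigma> assume "\<sigma> \<in> space M"
    moreover from this have "\<sigma> \<in> searching_strategies n h"
      using M by (auto simp: mixed_searching_strategies_def)
    ultimately have "(\<Sum>i<n. indicator (?A i) \<sigma>) = real (card {i. i < n \<and> searcher_wins h \<sigma> (?P i)})"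
      by (simp add: indicator_def of_bool_def sum.If_cases Int_def)
    with card_winning_bottoms_le[OF \<open>\<sigma> \<in> searching_strategies n h\<close> \<open>h > 0\<close>]
    show "(\<Sum>i<n. indicator (?A i) \<sigma>) \<le> real_of_int \<lfloor>h\<rfloor>" by linarith
  qed (use A in \<open>auto simp: emeasure_eq_measure\<close>)
  also have "\<dots> = \<lfloor>h\<rfloor>" by (simp add: prob_space)
  finally show ?thesis using \<open>n \<ge> 1\<close> by (simp add: field_simps)
qed

lemma lower_value_le:
  assumes "n \<ge> 1" "h > 0"
  shows "lower_value n h \<le> \<lfloor>h\<rfloor> / n"
proof -
  have "finite_mixture {()} (\<lambda>_ _ _ _. 0) \<in> mixed_searching_strategies n h"
    using idle_strategy(1)[of n h] by (intro finite_mixture(1)) auto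
  then show ?thesis
    unfolding lower_value_def using INF_winning_le[OF assms] by (intro cSUP_least) auto
qed

text \<open>One finite family of strategies bounds both values. For the upper value, the average
  over \<open>\<Omega>\<close> of the winning probabilities against any \<open>H\<close> is at least
  \<open>q\<close>, hence so is the supremum. Winning sets must be Borel because only Borel sets are
  certain to be events of \<open>H\<close>.\<close>

lemma values_ge:
  fixes q :: real
  assumes "n \<ge> 1" and fin: "finite \<Omega>" "\<Omega> \<noteq> {}"
    and f: "f ` \<Omega> \<subseteq> searching_strategies n h"
    and borel: "\<And>\<omega>. \<omega> \<in> \<Omega> \<Longrightarrow> winning_set n h (f \<omega>) \<in> sets (restrict_space borel (placements n))"
    and win: "\<And>P. P \<in> placements n \<Longrightarrow> q * card \<Omega> \<le> card {\<omega> \<in> \<Omega>. searcher_wins h (f \<omega>) P}"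
  shows "q \<le> lower_value n h" "q \<le> upper_value n h"
proof -
  have pos: "0 < real (card \<Omega>)" using fin by (simp add: card_gt_0_iff)
  have pl: "((0, 1), (0, 1)) \<in> placements n" using \<open>n \<ge> 1\<close> by (simp add: placements_iff)
  have "q \<le> (INF P \<in> placements n. measure (finite_mixture \<Omega> f)
      {\<sigma> \<in> space (finite_mixture \<Omega> f). searcher_wins h \<sigma> P})"
    using pl win pos by (intro cINF_greatest) (auto simp: finite_mixture(2)[OF fin f] pos_le_divide_eq)
  also have "\<dots> \<le> lower_value n h"
    unfolding lower_value_def
  proof (rule cSUP_upper[OF finite_mixture(1)[OF fin f]], rule bdd_aboveI2[of _ _ 1])
    fix M assume "M \<in> mixed_searching_strategies n h"
    then interpret prob_space M by (simp add: mixed_searching_strategies_def)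
    show "(INF P \<in> placements n. measure M {\<sigma> \<in> space M. searcher_wins h \<sigma> P}) \<le> 1"
      using pl by (intro cINF_lower2[OF bdd_belowI2[of _ 0] pl]) auto
  qed
  finally show "q \<le> lower_value n h" .
  show "q \<le> upper_value n h"
    unfolding upper_value_def
  proof (rule cINF_greatest)
    show "hiding_strategies n \<noteq> {}" using uniform_bottom_hiding_in[OF \<open>n \<ge> 1\<close>] by auto
    fix H assume H: "H \<in> hiding_strategies n"
    interpret prob_space H using H by (simp add: hiding_strategies_def)
    have space: "space H = placements n" using H by (simp add: hiding_strategies_def)
    have sets: "winning_set n h (f \<omega>) \<in> sets H" if "\<omega> \<in> \<Omega>" for \<omega>
      using H borel[OF that] by (auto simp: hiding_strategies_def)
    have "(\<integral>P. q * card \<Omega> \<partial>H) \<le> (\<integral>P. (\<Sum>\<omega>\<in>\<Omega>. indicator (winning_set n h (f \<omega>)) P) \<partial>H)"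
    proof (rule integral_mono)
      fix P assume P: "P \<in> space H"
      then have "(\<Sum>\<omega>\<in>\<Omega>. indicator (winning_set n h (f \<omega>)) P)
          = (\<Sum>\<omega>\<in>\<Omega>. if searcher_wins h (f \<omega>) P then 1 else (0::real))"
        by (intro sum.cong) (auto simp: winning_set_def space)
      also have "\<dots> = card {\<omega> \<in> \<Omega>. searcher_wins h (f \<omega>) P}"
        using fin by (simp add: sum.If_cases Int_def)
      finally show "q * card \<Omega> \<le> (\<Sum>\<omega>\<in>\<Omega>. indicator (winning_set n h (f \<omega>)) P)"
        using win P space by simp
    qed (use sets in \<open>auto simp: emeasure_eq_measure\<close>)
    also have "\<dots> = (\<Sum>\<omega>\<in>\<Omega>. measure H (winning_set n h (f \<omega>)))"
      using sets by (subst Bochner_Integration.integral_sum) (auto simp: emeasure_eq_measure)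
    also have "\<dots> \<le> (\<Sum>\<omega>\<in>\<Omega>. SUP \<sigma> \<in> {\<sigma> \<in> searching_strategies n h. winning_set n h \<sigma> \<in> sets H}.
        measure H (winning_set n h \<sigma>))"
      using f sets by (intro sum_mono SUP_winning_ge[OF H]) auto
    finally show "q \<le> (SUP \<sigma> \<in> {\<sigma> \<in> searching_strategies n h. winning_set n h \<sigma> \<in> sets H}.
        measure H (winning_set n h \<sigma>))"
      using pos by (simp add: prob_space mult.commute)
  qed
qed

section \<open>Parallel search\<close>

text \<open>The holes in \<open>S\<close> are dug at equal speed. Once a nut is found in hole \<open>i\<close> at depth \<open>x\<close>,
  each hole \<open>j\<close> is dug \<open>e i x j\<close> deeper, all at proportional speeds. If nuts in two holes are
  found simultaneously, the game is over and \<open>i\<close> is chosen arbitrarily.\<close>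

locale parallel_search =
  fixes n :: nat and h :: real and S :: "nat set" and e :: "nat \<Rightarrow> real \<Rightarrow> nat \<Rightarrow> real"
  assumes S_subset: "S \<subseteq> {..<n}" and S_nonempty: "S \<noteq> {}" and card_S: "real (card S) \<le> h"
    and e_nonneg: "\<And>i (x :: real) j. \<lbrakk>i \<in> S; 0 < x; x \<le> 1; j < n\<rbrakk> \<Longrightarrow> 0 \<le> e i x j"
    and e_self: "\<And>i (x :: real). i \<in> S \<Longrightarrow> e i x i = 1 - x"
    and e_sum: "\<And>i (x :: real). \<lbrakk>i \<in> S; 0 < x; x \<le> 1\<rbrakk> \<Longrightarrow> (\<Sum>j<n. e i x j) \<le> h - card S * x"
    and e_measurable [measurable]: "\<And>i j. (\<lambda>x. e i x j) \<in> borel_measurable borel"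
begin

text \<open>These are the only candidates for the first find, since the holes outside
  \<open>S\<close> stay untouched until then.\<close>

definition hits :: "placement \<Rightarrow> nut set"
  where "hits P = {(i, x). (i, x) \<in># nuts P \<and> i \<in> S}"

text \<open>Without hits the parallel digging ends at depth 1.\<close>

definition first_depth :: "placement \<Rightarrow> real"
  where "first_depth P = (if hits P = {} then 1 else Min (snd ` hits P))"

definition first_hole :: "placement \<Rightarrow> nat"
  where "first_hole P = Min {i. (i, first_depth P) \<in> hits P}"

text \<open>The denominator is the time left after the first find, so that by time \<open>h\<close>
  hole \<open>j\<close> is deepened by the whole of \<open>e\<close>.\<close>

definition rate :: "placement \<Rightarrow> nat \<Rightarrow> real"
  where "rate P j = (if hits P = {} then 0
    else e (first_hole P) (first_depth P) j / (h - card S * first_depth P))"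

definition search :: strategy
  where "search P t j = (if j \<in> S then min (t / card S) (first_depth P) else 0)
    + rate P j * max 0 (t - card S * first_depth P)"

lemma card_S_pos: "0 < real (card S)"
  using S_subset S_nonempty by (auto simp: card_gt_0_iff dest: finite_subset)

lemma finite_hits: "finite (hits P)"
  by (rule finite_subset[of _ "set_mset (nuts P)"]) (auto simp: hits_def)

lemma first_hit:
  assumes "hits P \<noteq> {}"
  shows "(first_hole P, first_depth P) \<in> hits P"
proof -
  have "Min (snd ` hits P) \<in> snd ` hits P" using assms finite_hits by (intro Min_in) auto
  then have "{i. (i, first_depth P) \<in> hits P} \<noteq> {}" using assms by (auto simp: first_depth_def)
  moreover have "finite {i. (i, first_depth P) \<in> hits P}"
    by (rule finite_subset[of _ "fst ` hits P"]) (auto simp: finite_hits intro: rev_image_eqI)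
  ultimately show ?thesis unfolding first_hole_def using Min_in by blast
qed

lemma first_depth_le: "(i, x) \<in> hits P \<Longrightarrow> first_depth P \<le> x"
  using Min_le[of "snd ` hits P" x] finite_hits[of P] rev_image_eqI[of "(i, x)" "hits P" x snd]
  by (auto simp: first_depth_def)

lemma hits_placement:
  assumes "P \<in> placements n" "(i, x) \<in> hits P"
  shows "i \<in> S" "0 < x" "x \<le> 1"
  using assms(2) placements_nutD[OF assms(1), of i x] by (auto simp: hits_def)

lemma first_depth_bounds:
  assumes "P \<in> placements n"
  shows "0 < first_depth P" "first_depth P \<le> 1"
  using hits_placement[OF assms first_hit] by (cases "hits P = {}"; simp add: first_depth_def)+

lemma first_time_le:
  assumes "P \<in> placements n"
  shows "card S * first_depth P \<le> h"
proof -
  have "card S * first_depth P \<le> real (card S) * 1"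
    using first_depth_bounds[OF assms] by (intro mult_left_mono) auto
  with card_S show ?thesis by simp
qed

lemma rate:
  assumes P: "P \<in> placements n"
  shows "j < n \<Longrightarrow> 0 \<le> rate P j" "(\<Sum>j<n. rate P j) \<le> 1"
proof -
  note first = hits_placement[OF P first_hit]
  show "0 \<le> rate P j" if "j < n"
    using e_nonneg[OF first that] first_time_le[OF P] by (simp add: rate_def)
  show "(\<Sum>j<n. rate P j) \<le> 1"
  proof (cases "hits P = {}")
    case False
    then have "(\<Sum>j<n. rate P j)
        = (\<Sum>j<n. e (first_hole P) (first_depth P) j) / (h - card S * first_depth P)"
      by (simp add: rate_def sum_divide_distrib)
    also have "\<dots> \<le> 1"
      using e_sum[OF first(1) first(2,3), OF False False False] first_time_le[OF P]
      by (auto simp: divide_le_eq_1)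
    finally show ?thesis .
  qed (simp add: rate_def)
qed

lemma search_path:
  assumes P: "P \<in> placements n"
  shows "digging_path n h (search P)"
  unfolding digging_path_def
proof (intro conjI allI impI; (elim conjE)?)
  let ?k = "real (card S)" and ?x = "first_depth P"
  have kx: "0 < ?k * ?x" using card_S_pos first_depth_bounds[OF P] by simp
  show "search P 0 j = 0" for j
    using kx first_depth_bounds[OF P] by (simp add: search_def)
  fix s t :: real assume st: "0 \<le> s" "s \<le> t" "t \<le> h"
  show "search P s j \<le> search P t j" if "j < n" for j
    unfolding search_def using st card_S_pos
    by (intro add_mono mult_left_mono rate(1)[OF P that]) (auto simp: divide_right_mono min_le_iff_disj)
  have min: "?k * min (u / ?k) ?x = min u (?k * ?x)" for u
    using card_S_pos by (auto simp: min_def field_simps)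
  have "(\<Sum>j<n. search P t j - search P s j)
    = (\<Sum>j<n. (if j \<in> S then min (t / ?k) ?x - min (s / ?k) ?x else 0)
        + rate P j * (max 0 (t - ?k * ?x) - max 0 (s - ?k * ?x)))"
    by (intro sum.cong) (auto simp: search_def algebra_simps)
  also have "\<dots> = ?k * (min (t / ?k) ?x - min (s / ?k) ?x)
      + (\<Sum>j<n. rate P j) * (max 0 (t - ?k * ?x) - max 0 (s - ?k * ?x))"
    using S_subset by (simp add: sum.distrib sum_distrib_right sum.If_cases Int_absorb1)
  also have "\<dots> \<le> ?k * (min (t / ?k) ?x - min (s / ?k) ?x)
      + 1 * (max 0 (t - ?k * ?x) - max 0 (s - ?k * ?x))"
    using st by (intro add_left_mono mult_right_mono rate(2)[OF P]) auto
  \<comment> \<open>The two phases together account for all time: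
    \<open>min u c + max 0 (u - c) = u\<close>, here with \<open>c = ?k * ?x\<close>.\<close>
  also have "\<dots> = t - s"
    unfolding right_diff_distrib min by (auto simp: min_def max_def)
  finally show "(\<Sum>j<n. search P t j - search P s j) \<le> t - s" .
qed

lemma search_before:
  assumes "t \<le> card S * first_depth P"
  shows "search P t j = (if j \<in> S then t / card S else 0)"
  using assms card_S_pos by (auto simp: search_def min_def field_simps)

lemma found_before:
  assumes P: "P \<in> placements n" and "0 \<le> t" "t \<le> card S * first_depth P"
  shows "set_mset (found P (search P t)) = {(i, x) \<in> hits P. real (card S) * x \<le> t}"
proof (rule set_eqI)
  fix p :: nut
  obtain i and x :: real where p: "p = (i, x)" by fastforce
  show "p \<in># found P (search P t) \<longleftrightarrow> p \<in> {(i, x) \<in> hits P. real (card S) * x \<le> t}"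
    using card_S_pos placements_nutD(2)[OF P, of i x]
    by (auto simp: p found_def hits_def search_before[OF assms(3)] field_simps)
qed

text \<open>The finds at the time of the first hit thus tell whether there is any hit at
  all.\<close>

lemma hits_eq_empty_iff: "{(i, x) \<in> hits P. x = first_depth P} = {} \<longleftrightarrow> hits P = {}"
  using first_hit by blast

lemma found_first:
  assumes P: "P \<in> placements n"
  shows "set_mset (found P (search P (card S * first_depth P))) = {(i, x) \<in> hits P. x = first_depth P}"
proof -
  have "real (card S) * x \<le> card S * first_depth P \<longleftrightarrow> x = first_depth P" if "(i, x) \<in> hits P" for i and x :: real
    using first_depth_le[OF that] card_S_pos by auto
  then have "{(i, x) \<in> hits P. real (card S) * x \<le> card S * first_depth P} = {(i, x) \<in> hits P. x = first_depth P}"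
    by blast
  then show ?thesis using first_depth_bounds[OF P] by (simp add: found_before[OF P])
qed

lemma found_empty:
  assumes P: "P \<in> placements n" and "0 \<le> t" "t < card S * first_depth P"
  shows "set_mset (found P (search P t)) = {}"
proof -
  have False if "(i, x) \<in> hits P" "real (card S) * x \<le> t" for i and x :: real
    using that first_depth_le[OF that(1)] assms(3) card_S_pos
    by (smt (verit) mult_left_mono)
  then show ?thesis using assms by (auto simp: found_before)
qed

text \<open>Up to the first find the digging is the same for all placements. Beyond it, the equal
  finds at that moment reveal the depth and the hole of the first hit, which determine the rest. The
  order of the first depths is assumed by symmetry.\<close>

lemma search_nonanticipating:
  assumes P: "P \<in> placements n" and Q: "Q \<in> placements n"
    and eq: "\<forall>s \<in> {0..<t}. found P (search P s) = found Q (search Q s)"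
    and le: "first_depth P \<le> first_depth Q"
  shows "search P t = search Q t"
proof (cases "t \<le> card S * first_depth P")
  case True
  moreover have "card S * first_depth P \<le> card S * first_depth Q" using le by (intro mult_left_mono) auto
  ultimately have "t \<le> card S * first_depth Q" by (rule order.trans)
  then show ?thesis using True by (auto simp: search_before)
next
  case False
  let ?s = "card S * first_depth P"
  have s: "?s \<in> {0..<t}" using False first_depth_bounds[OF P] by simp
  then have found: "{(i, x) \<in> hits P. x = first_depth P} = set_mset (found Q (search Q ?s))"
    using eq found_first[OF P] by metis
  \<comment> \<open>If \<open>Q\<close> had its first hit later, the equal finds would mean that
    \<open>P\<close> has no hit; but then \<open>first_depth P\<close> is the default 1, which no
    first depth exceeds.\<close>
  have depth: "first_depth P = first_depth Q"
  proof (rule ccontr)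
    assume "first_depth P \<noteq> first_depth Q"
    then have less: "first_depth P < first_depth Q" using le by simp
    then have "?s < card S * first_depth Q" using card_S_pos by simp
    then have "set_mset (found Q (search Q ?s)) = {}" using s by (intro found_empty[OF Q]) auto
    then have "hits P = {}" using found hits_eq_empty_iff by simp
    then show False using less first_depth_bounds[OF Q] by (simp add: first_depth_def)
  qed
  have hits: "{(i, x) \<in> hits P. x = first_depth P} = {(i, x) \<in> hits Q. x = first_depth Q}"
    using found found_first[OF Q] depth by simp
  then have "hits P = {} \<longleftrightarrow> hits Q = {}"
    unfolding hits_eq_empty_iff[symmetric] by (rule arg_cong[where f = "\<lambda>A. A = {}"])
  moreover have "(i, first_depth P) \<in> hits P \<longleftrightarrow> (i, first_depth Q) \<in> hits Q" for i
    using eqset_imp_iff[OF hits, of "(i, first_depth P)"] depth by simp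
  then have "first_hole P = first_hole Q" by (simp add: first_hole_def)
  ultimately show ?thesis using depth by (auto simp: search_def rate_def fun_eq_iff)
qed

lemma search_strategy: "search \<in> searching_strategies n h"
  unfolding searching_strategies_def
proof (intro CollectI conjI ballI impI allI)
  show "digging_path n h (search P)" if "P \<in> placements n" for P using that by (rule search_path)
  fix P Q t k
  assume "P \<in> placements n" "Q \<in> placements n"
    "\<forall>s \<in> {0..<t}. found P (search P s) = found Q (search Q s)"
  then show "search P t k = search Q t k"
    using search_nonanticipating[of P Q t] search_nonanticipating[of Q P t]
    by (metis linear)
qed

lemma search_final:
  assumes P: "P \<in> placements n" and "j < n"
  shows "search P h j = (if j \<in> S then first_depth P else 0)
    + (if hits P = {} then 0 else e (first_hole P) (first_depth P) j)"
proof -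
  let ?x = "first_depth P"
  have min: "min (h / card S) ?x = ?x"
    using first_time_le[OF P] card_S_pos by (simp add: min_def field_simps)
  \<comment> \<open>When no time is left, the division by zero in \<open>rate\<close> yields 0. This
    is the right value, as all extensions are nonnegative with sum at most 0.\<close>
  have "e (first_hole P) ?x j = 0" if ne: "hits P \<noteq> {}" and h: "h = card S * ?x"
  proof -
    note first = hits_placement[OF P first_hit[OF ne]]
    have "e (first_hole P) ?x j \<le> (\<Sum>j<n. e (first_hole P) ?x j)"
      using e_nonneg[OF first] \<open>j < n\<close> by (intro member_le_sum) auto
    with e_sum[OF first] e_nonneg[OF first \<open>j < n\<close>] h show ?thesis by simp
  qed
  then show ?thesis
    using first_time_le[OF P] by (auto simp: search_def rate_def min)
qed

text \<open>This describes a win in which \<open>(i, x)\<close> counts as the first find, ties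
  included. It is a condition on the depths alone, which gives measurability of the winning
  set.\<close>

definition wins_via :: "nat \<Rightarrow> real \<Rightarrow> nat \<Rightarrow> real \<Rightarrow> bool"
  where "wins_via i x j y \<longleftrightarrow>
    i \<in> S \<and> (j \<in> S \<longrightarrow> x \<le> y) \<and> y \<le> (if j \<in> S then x else 0) + e i x j"

text \<open>Assuming only the multiset of nuts allows either nut of a listed placement to play the
  role of \<open>(i, x)\<close>.\<close>

lemma searcher_wins_first:
  assumes P: "P \<in> placements n" and nuts: "nuts P = {#(i, x), (j, y)#}"
    and i: "i \<in> S" and le: "j \<in> S \<longrightarrow> x \<le> y"
  shows "searcher_wins h search P \<longleftrightarrow> y \<le> (if j \<in> S then x else 0) + e i x j"
proof -
  have ij: "i < n" "j < n" and x: "0 < x" "x \<le> 1"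
    using placements_nutD[OF P, of i x] placements_nutD[OF P, of j y] nuts by auto
  have hits: "hits P = insert (i, x) (if j \<in> S then {(j, y)} else {})"
    using i by (auto simp: hits_def nuts)
  then have ne: "hits P \<noteq> {}" by simp
  have depth: "first_depth P = x" using le by (auto simp: first_depth_def hits)
  have wins: "searcher_wins h search P \<longleftrightarrow> x \<le> search P h i \<and> y \<le> search P h j"
    by (simp add: searcher_wins_iff nuts)
  have first: "first_hole P \<in> S" using hits_placement(1)[OF P first_hit[OF ne]] .
  have nonneg: "0 \<le> e (first_hole P) x i" "0 \<le> e (first_hole P) x j" "0 \<le> e i x j"
    using e_nonneg first i ij x by auto
  show ?thesis
  \<comment> \<open>In a tie between two holes \<open>first_hole P\<close> may be \<open>j\<close>,
    but then both nuts are found already and both sides hold.\<close>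
  proof (cases "j \<in> S \<and> x = y \<and> i \<noteq> j")
    case True
    then show ?thesis
      using nonneg i by (simp add: wins search_final[OF P] ij ne depth)
  next
    case False
    then have "{i. (i, x) \<in> hits P} = {i}" by (auto simp: hits)
    then have "first_hole P = i" by (simp add: first_hole_def depth)
    then show ?thesis using nonneg i by (simp add: wins search_final[OF P] ij ne depth)
  qed
qed

lemma searcher_wins_search:
  assumes P: "((i, x), (j, y)) \<in> placements n"
  shows "searcher_wins h search ((i, x), (j, y)) \<longleftrightarrow> wins_via i x j y \<or> wins_via j y i x"
proof -
  have i: "i < n" and x: "0 < x"
    using placements_nutD[OF P, of i x] by auto
  note first = searcher_wins_first[OF P, of i x j y]
    searcher_wins_first[OF P, of j y i x, simplified]
  consider "i \<in> S" "j \<in> S \<longrightarrow> x \<le> y" | "j \<in> S" "i \<in> S \<longrightarrow> y \<le> x" | "i \<notin> S" "j \<notin> S" by force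
  then show ?thesis
  proof cases
    case 1
    then show ?thesis using first by (auto simp: wins_via_def)
  next
    case 2
    then show ?thesis using first by (auto simp: wins_via_def)
  next
    case 3
    then have "hits ((i, x), (j, y)) = {}" by (auto simp: hits_def)
    then have "search ((i, x), (j, y)) h i = 0" using 3 i by (simp add: search_final[OF P])
    then show ?thesis using 3 x by (simp add: searcher_wins_iff wins_via_def)
  qed
qed

lemma searcher_wins_same_hole:
  assumes "((i, x), (i, y)) \<in> placements n" "i \<in> S"
  shows "searcher_wins h search ((i, x), (i, y))"
  using assms placements_nutD(3)[OF assms(1), of i x] placements_nutD(3)[OF assms(1), of i y]
  by (auto simp: searcher_wins_search wins_via_def e_self)

text \<open>For fixed holes, winning is a Borel condition on the two depths, and fixing the holes is
  a closed condition. The winning set is the countable union over pairs of holes.\<close>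

lemma winning_set_search_borel:
  "winning_set n h search \<in> sets (restrict_space borel (placements n))"
proof -
  let ?W = "\<Union>i. \<Union>j. {P. fst (fst P) = i} \<inter> {P. fst (snd P) = j} \<inter>
    {P :: placement. wins_via i (snd (fst P)) j (snd (snd P)) \<or> wins_via j (snd (snd P)) i (snd (fst P))}"
  have [measurable]: "(\<lambda>P :: placement. snd (fst P)) \<in> borel_measurable borel"
    "(\<lambda>P :: placement. snd (snd P)) \<in> borel_measurable borel"
    by (intro borel_measurable_continuous_onI continuous_intros)+
  have closed: "closed {P :: placement. fst (fst P) = i}" "closed {P :: placement. fst (snd P) = i}" for i
    by (intro closed_Collect_eq continuous_intros)+
  have "{P :: placement. wins_via i (snd (fst P)) j (snd (snd P)) \<or> wins_via j (snd (snd P)) i (snd (fst P))}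
      \<in> sets borel" for i j
    unfolding wins_via_def by measurable
  then have "?W \<in> sets borel" using closed by (intro sets.countable_UN sets.Int) auto
  moreover have "winning_set n h search = placements n \<inter> ?W"
  proof (rule set_eqI)
    fix P :: placement
    obtain i x j y where "P = ((i, x), (j, y))" by (metis surj_pair)
    then show "P \<in> winning_set n h search \<longleftrightarrow> P \<in> placements n \<inter> ?W"
      using searcher_wins_search[of i x j y] by (simp add: winning_set_def cong: conj_cong)
  qed
  ultimately show ?thesis unfolding sets_restrict_space by (intro image_eqI)
qed

end

section \<open>Uniformly random positions\<close>

text \<open>The inequality between fibres holds in both directions, so all fibres have equal size
  and \<open>f\<close> is uniformly distributed on \<open>X\<close>. The probability is stated
  without division to stay within the natural numbers.\<close>

lemma card_vimage_equal_fibres: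
  assumes fin: "finite \<Omega>" "finite X" and f: "f ` \<Omega> \<subseteq> X" and "W \<subseteq> X"
    and fibres: "\<And>a b. a \<in> X \<Longrightarrow> b \<in> X \<Longrightarrow> card {\<omega> \<in> \<Omega>. f \<omega> = a} \<le> card {\<omega> \<in> \<Omega>. f \<omega> = b}"
  shows "card {\<omega> \<in> \<Omega>. f \<omega> \<in> W} * card X = card \<Omega> * card W"
proof (cases "X = {}")
  case True
  then show ?thesis using f by auto
next
  case False
  then obtain b where b: "b \<in> X" by auto
  have count: "card {\<omega> \<in> \<Omega>. f \<omega> \<in> V} = card V * card {\<omega> \<in> \<Omega>. f \<omega> = b}" if "V \<subseteq> X" for V
  proof -
    have "{\<omega> \<in> \<Omega>. f \<omega> \<in> V} = (\<Union>a\<in>V. {\<omega> \<in> \<Omega>. f \<omega> = a})" by auto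
    also have "card \<dots> = (\<Sum>a\<in>V. card {\<omega> \<in> \<Omega>. f \<omega> = a})"
      using fin that by (intro card_UN_disjoint) (auto dest: finite_subset)
    also have "\<dots> = (\<Sum>a\<in>V. card {\<omega> \<in> \<Omega>. f \<omega> = b})"
      using fibres b that by (intro sum.cong antisym) auto
    finally show ?thesis by simp
  qed
  have "{\<omega> \<in> \<Omega>. f \<omega> \<in> X} = \<Omega>" using f by auto
  then show ?thesis using count[OF \<open>W \<subseteq> X\<close>] count[of X] by simp
qed

text \<open>Composition with \<open>\<tau>\<close> injects one fibre into the other.\<close>

lemma permutation_fibres:
  fixes n :: nat
  assumes "\<tau> permutes {..<n}" "\<And>\<pi>. f \<pi> = a \<Longrightarrow> f (\<tau> \<circ> \<pi>) = b"
  shows "card {\<pi> \<in> {\<pi>. \<pi> permutes {..<n}}. f \<pi> = a} \<le> card {\<pi> \<in> {\<pi>. \<pi> permutes {..<n}}. f \<pi> = b}"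
proof (rule card_inj_on_le[of "(\<circ>) \<tau>"])
  have "inj \<tau>" using assms(1) by (rule permutes_inj)
  then show "inj_on ((\<circ>) \<tau>) {\<pi> \<in> {\<pi>. \<pi> permutes {..<n}}. f \<pi> = a}"
    by (auto intro!: inj_onI simp: fun_eq_iff inj_eq)
qed (use assms in \<open>auto intro: permutes_compose finite_permutations\<close>)

lemma card_permutations_position:
  fixes n :: nat
  assumes "i < n" "W \<subseteq> {..<n}"
  shows "card {\<pi>. \<pi> permutes {..<n} \<and> \<pi> i \<in> W} * n = card {\<pi>. \<pi> permutes {..<n}} * card W"
proof -
  have "card {\<pi> \<in> {\<pi>. \<pi> permutes {..<n}}. \<pi> i \<in> W} * card {..<n} = card {\<pi>. \<pi> permutes {..<n}} * card W"
  proof (rule card_vimage_equal_fibres)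
    show "(\<lambda>\<pi>. \<pi> i) ` {\<pi>. \<pi> permutes {..<n}} \<subseteq> {..<n}"
      using assms permutes_in_image by fastforce
    fix a b assume "a \<in> {..<n}" "b \<in> {..<n}"
    then show "card {\<pi> \<in> {\<pi>. \<pi> permutes {..<n}}. \<pi> i = a} \<le> card {\<pi> \<in> {\<pi>. \<pi> permutes {..<n}}. \<pi> i = b}"
      by (intro permutation_fibres[of "Transposition.transpose a b"] permutes_swap_id) auto
  qed (use assms in \<open>auto intro: finite_permutations\<close>)
  then show ?thesis by simp
qed

lemma card_permutations_positions:
  fixes n :: nat
  assumes "i < n" "j < n" "i \<noteq> j" and W: "W \<subseteq> {(p, q). p < n \<and> q < n \<and> p \<noteq> q}"
  shows "card {\<pi>. \<pi> permutes {..<n} \<and> (\<pi> i, \<pi> j) \<in> W} * (n * (n - 1))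
    = card {\<pi>. \<pi> permutes {..<n}} * card W"
proof -
  let ?X = "{(p, q). p < n \<and> q < n \<and> p \<noteq> q}"
  have X: "?X = (SIGMA p:{..<n}. {..<n} - {p})" by auto
  have "card {\<pi> \<in> {\<pi>. \<pi> permutes {..<n}}. (\<pi> i, \<pi> j) \<in> W} * card ?X
    = card {\<pi>. \<pi> permutes {..<n}} * card W"
  proof (rule card_vimage_equal_fibres)
    show "(\<lambda>\<pi>. (\<pi> i, \<pi> j)) ` {\<pi>. \<pi> permutes {..<n}} \<subseteq> ?X"
    proof clarsimp
      fix \<pi> assume \<pi>: "\<pi> permutes {..<n}"
      have "\<pi> i \<in> {..<n}" "\<pi> j \<in> {..<n}" using permutes_in_image[OF \<pi>] assms by auto
      moreover have "\<pi> i \<noteq> \<pi> j" using permutes_inj[OF \<pi>] \<open>i \<noteq> j\<close> by (auto simp: inj_eq)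
      ultimately show "\<pi> i < n \<and> \<pi> j < n \<and> \<pi> i \<noteq> \<pi> j" by auto
    qed
    fix a b assume "a \<in> ?X" "b \<in> ?X"
    then obtain p q p' q' where ab: "a = (p, q)" "b = (p', q')" "p < n" "q < n" "p \<noteq> q"
      "p' < n" "q' < n" "p' \<noteq> q'" by auto
    \<comment> \<open>Exchanging \<open>p\<close> and \<open>p'\<close> sends \<open>p\<close> to
      \<open>p'\<close> and \<open>q\<close> to \<open>?u\<close>. As \<open>p'\<close> differs from
      both \<open>?u\<close> and \<open>q'\<close>, exchanging these two afterwards corrects the
      second entry and keeps the first.\<close>
    let ?u = "Transposition.transpose p p' q"
    have u: "?u \<noteq> p'" "?u < n" using ab by (auto simp: Transposition.transpose_def)
    show "card {\<pi> \<in> {\<pi>. \<pi> permutes {..<n}}. (\<pi> i, \<pi> j) = a}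
        \<le> card {\<pi> \<in> {\<pi>. \<pi> permutes {..<n}}. (\<pi> i, \<pi> j) = b}"
    proof (rule permutation_fibres[of "Transposition.transpose ?u q' \<circ> Transposition.transpose p p'"])
      show "Transposition.transpose ?u q' \<circ> Transposition.transpose p p' permutes {..<n}"
        using ab u by (intro permutes_compose permutes_swap_id) auto
      show "(((Transposition.transpose ?u q' \<circ> Transposition.transpose p p') \<circ> \<pi>) i, ((Transposition.transpose ?u q' \<circ> Transposition.transpose p p') \<circ> \<pi>) j) = b"
        if "(\<pi> i, \<pi> j) = a" for \<pi> :: "nat \<Rightarrow> nat"
        using that ab u by simp
    qed
  qed (use W in \<open>auto intro: finite_permutations simp: X\<close>)
  moreover have "card ?X = n * (n - 1)" unfolding X by (subst card_SigmaI) auto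
  ultimately show ?thesis by simp
qed

section \<open>The optimal mixed search\<close>

text \<open>The hole at position \<open>p < k\<close> with the first nut is emptied. The holes at \<open>k - 1\<close> further
  positions \<open>D p\<close> are searched completely; at most one position outside the initially searched
  ones remains, and half a unit of digging is left for it.\<close>

locale position_search =
  fixes n k :: nat and h :: real and D :: "nat \<Rightarrow> nat set"
  assumes k: "1 \<le> k" "k \<le> n" "real k \<le> h"
    and D_subset: "\<And>p. p < k \<Longrightarrow> D p \<subseteq> {..<n} - {p}"
    and card_D: "\<And>p. p < k \<Longrightarrow> card (D p) = k - 1"
    and rest: "\<And>p. p < k \<Longrightarrow> card ({k..<n} - D p) / 2 \<le> h - k"
begin

text \<open>A position \<open>q < k\<close> has already been dug to depth \<open>x\<close>, so
  \<open>1 - x\<close> more empties it. For \<open>k \<le> q\<close> the depth \<open>1 - x\<close>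
  is the largest one that a second nut in another hole can have.\<close>

definition extension :: "nat \<Rightarrow> real \<Rightarrow> nat \<Rightarrow> real"
  where "extension p x q = (if q \<in> insert p (D p) then 1 - x
    else if k \<le> q then min (1 / 2) (1 - x) else 0)"

text \<open>The permutation assigns positions to the holes; drawn uniformly, it makes the ordered
  pairs of distinct positions of two given holes equally likely.\<close>

definition strategy_at :: "(nat \<Rightarrow> nat) \<Rightarrow> strategy"
  where "strategy_at \<pi> = parallel_search.search h {i. \<pi> i < k} (\<lambda>i x j. extension (\<pi> i) x (\<pi> j))"

text \<open>The \<open>k\<close> positions in \<open>insert p (D p)\<close> cost
  \<open>k * (1 - x)\<close>, and the others from \<open>k\<close> on cost at most 1/2 each, which
  \<open>rest\<close> bounds by \<open>h - k\<close> in total.\<close>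

lemma sum_extension_le:
  fixes x :: real
  assumes "p < k" "0 < x" "x \<le> 1"
  shows "(\<Sum>q<n. extension p x q) \<le> h - k * x"
proof -
  have fin: "finite (D p)" using D_subset[OF \<open>p < k\<close>] by (auto dest: finite_subset)
  have "p \<notin> D p" using D_subset[OF \<open>p < k\<close>] by auto
  then have card: "card (insert p (D p)) = k"
    using fin card_D[OF \<open>p < k\<close>] k by simp
  have sub: "insert p (D p) \<subseteq> {..<n}" using D_subset[OF \<open>p < k\<close>] \<open>p < k\<close> k by auto
  have "(\<Sum>q<n. extension p x q) \<le> (\<Sum>q<n. (if q \<in> insert p (D p) then 1 - x else 0)
      + (if q \<in> {k..<n} - D p then 1 / 2 else 0))"
    using assms by (intro sum_mono) (auto simp: extension_def min_def)
  also have "\<dots> = card ({..<n} \<inter> insert p (D p)) * (1 - x) + card ({..<n} \<inter> ({k..<n} - D p)) / 2"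
    unfolding sum.distrib 
    by (auto simp: sum.If_cases simp del: insert_iff intro!: arg_cong[where f = card])
  also have "{..<n} \<inter> insert p (D p) = insert p (D p)" using sub by blast
  also have "{..<n} \<inter> ({k..<n} - D p) = {k..<n} - D p" by auto
  also have "card (insert p (D p)) * (1 - x) + card ({k..<n} - D p) / 2 \<le> k * (1 - x) + (h - k)"
    unfolding card using rest[OF \<open>p < k\<close>] by (intro add_left_mono)
  finally show ?thesis by (simp add: algebra_simps)
qed

lemma parallel_search_at:
  assumes \<pi>: "\<pi> permutes {..<n}"
  shows "parallel_search n h {i. \<pi> i < k} (\<lambda>i x j. extension (\<pi> i) x (\<pi> j))"
proof
  have sub: "{i. \<pi> i < k} \<subseteq> {..<n}"
  proof (intro subsetI, rule ccontr)
    fix i assume "i \<in> {i. \<pi> i < k}" "i \<notin> {..<n}"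
    then show False using permutes_not_in[OF \<pi>, of i] k by simp
  qed
  have "\<pi> ` {i. \<pi> i < k} = {..<k}"
    using surj_image_vimage_eq[OF permutes_surj[OF \<pi>], of "{..<k}"] by (simp add: vimage_def)
  then have card: "card {i. \<pi> i < k} = k"
    using card_image[OF inj_on_subset[OF permutes_inj[OF \<pi>]], of "{i. \<pi> i < k}"] by simp
  show "{i. \<pi> i < k} \<subseteq> {..<n}" by fact
  show "{i. \<pi> i < k} \<noteq> {}" using card k by (metis card.empty not_one_le_zero)
  show "card {i. \<pi> i < k} \<le> h" using card k by simp
  show "0 \<le> extension (\<pi> i) x (\<pi> j)" if "x \<le> 1" for i j and x :: real
    using that by (simp add: extension_def)
  show "extension (\<pi> i) x (\<pi> i) = 1 - x" for i and x :: real by (simp add: extension_def)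
  show "(\<Sum>j<n. extension (\<pi> i) x (\<pi> j)) \<le> h - card {i. \<pi> i < k} * x"
    if "i \<in> {i. \<pi> i < k}" "0 < x" "x \<le> 1" for i and x :: real
    using sum_extension_le[of "\<pi> i" x] that card sum.permute[OF \<pi>, of "extension (\<pi> i) x"] by (simp add: o_def)
  show "(\<lambda>x. extension (\<pi> i) x (\<pi> j)) \<in> borel_measurable borel" for i j
    unfolding extension_def by measurable
qed

text \<open>The first component is the position of the shallower nut, the second that of the deeper
  one.\<close>

definition winning_positions :: "(nat \<times> nat) set"
  where "winning_positions = Sigma {..<k} D \<union> {k..<n} \<times> {..<k}"

lemma winning_positions_subset: "winning_positions \<subseteq> {(p, q). p < n \<and> q < n \<and> p \<noteq> q}"
proof
  fix w assume "w \<in> winning_positions"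
  then obtain p q where w: "w = (p, q)" "p < k \<and> q \<in> D p \<or> k \<le> p \<and> p < n \<and> q < k"
    by (auto simp: winning_positions_def)
  then show "w \<in> {(p, q). p < n \<and> q < n \<and> p \<noteq> q}" using D_subset[of p] k by auto
qed

lemma card_winning_positions: "card winning_positions = k * (n - 1)"
proof -
  have fin: "finite (D p)" if "p < k" for p using D_subset[OF that] by (auto dest: finite_subset)
  have "card winning_positions = card (Sigma {..<k} D) + card ({k..<n} \<times> {..<k})"
    unfolding winning_positions_def using fin by (intro card_Un_disjoint) auto
  also have "card (Sigma {..<k} D) = k * (k - 1)"
    using fin card_D by (subst card_SigmaI) auto
  finally have card: "card winning_positions = k * (k - 1) + (n - k) * k" by simp
  \<comment> \<open>Writing \<open>n\<close> and \<open>k\<close> as sums removes the truncated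
    subtractions from \<open>k * (k - 1) + (n - k) * k = k * (n - 1)\<close>.\<close>
  obtain a where "n = k + a" using k le_Suc_ex by blast
  moreover obtain b where "k = Suc b" using k by (cases k) auto
  ultimately show ?thesis unfolding card by (simp add: algebra_simps)
qed

text \<open>The nut at depth \<open>x \<le> y\<close> has \<open>x \<le> 1 / 2\<close>: when the other one is found first, half a unit
  of digging, or all of the permitted depth, is enough to reach it.\<close>

lemma strategy_at_wins:
  assumes \<pi>: "\<pi> permutes {..<n}" and P: "((i, x), (j, y)) \<in> placements n"
    and "i \<noteq> j" "x \<le> y" "(\<pi> i, \<pi> j) \<in> winning_positions"
  shows "searcher_wins h (strategy_at \<pi>) ((i, x), (j, y))"
    and "searcher_wins h (strategy_at \<pi>) ((j, y), (i, x))"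
proof -
  interpret parallel_search n h "{i. \<pi> i < k}" "\<lambda>i x j. extension (\<pi> i) x (\<pi> j)"
    using parallel_search_at[OF \<pi>] .
  have xy: "0 < x" "0 < y" "x + y \<le> 1" using P \<open>i \<noteq> j\<close> by (auto simp: placements_iff)
  have Q: "((j, y), (i, x)) \<in> placements n" using P by (auto simp: placements_iff add.commute split: if_splits)
  have "wins_via i x j y \<or> wins_via j y i x"
    unfolding wins_via_def using assms(4,5) xy
    by (auto simp: winning_positions_def extension_def)
  then show "searcher_wins h (strategy_at \<pi>) ((i, x), (j, y))"
    "searcher_wins h (strategy_at \<pi>) ((j, y), (i, x))"
    unfolding strategy_at_def using searcher_wins_search[OF P] searcher_wins_search[OF Q] by auto
qed

text \<open>This says without division that the winning probability is at least
  \<open>k / n\<close>: through the \<open>k\<close> initial positions for a common hole, and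
  through \<open>k * (n - 1)\<close> of the \<open>n * (n - 1)\<close> pairs of positions for two
  holes.\<close>

lemma card_winning_permutations:
  assumes P: "((i, x), (j, y)) \<in> placements n"
  shows "card {\<pi>. \<pi> permutes {..<n}} * k
    \<le> card {\<pi> \<in> {\<pi>. \<pi> permutes {..<n}}. searcher_wins h (strategy_at \<pi>) ((i, x), (j, y))} * n"
    (is "?N * k \<le> card ?A * n")
proof -
  have finA: "finite ?A" by (rule finite_subset[OF _ finite_permutations[of "{..<n}"]]) auto
  have ij: "i < n" "j < n" using P by (auto simp: placements_iff)
  show ?thesis
  proof (cases "i = j")
    case True
    have "searcher_wins h (strategy_at \<pi>) ((i, x), (j, y))" if "\<pi> permutes {..<n}" "\<pi> i < k" for \<pi>
      unfolding strategy_at_def using True that P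
        parallel_search.searcher_wins_same_hole[OF parallel_search_at[OF that(1)]] by auto
    then have le: "card {\<pi>. \<pi> permutes {..<n} \<and> \<pi> i \<in> {..<k}} \<le> card ?A"
      by (intro card_mono finA) auto
    have "?N * k = card {\<pi>. \<pi> permutes {..<n} \<and> \<pi> i \<in> {..<k}} * n"
      using card_permutations_position[OF ij(1), of "{..<k}"] k by simp
    also have "\<dots> \<le> card ?A * n" using le by (rule mult_le_mono1)
    finally show ?thesis .
  next
    case False
    \<comment> \<open>Here \<open>a\<close> is to be the hole of the shallower nut and
      \<open>b\<close> that of the deeper one. Two distinct holes force \<open>n > 1\<close>, so the
      factor \<open>n - 1\<close> cancels.\<close>
    have pairs: "?N * k \<le> card ?A * n"
      if ab: "a < n" "b < n" "a \<noteq> b" and win: "\<And>\<pi>. \<pi> permutes {..<n} \<Longrightarrow> (\<pi> a, \<pi> b) \<in> winning_positions \<Longrightarrow> \<pi> \<in> ?A"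
      for a b
    proof -
      have "?N * k * (n - 1) = card {\<pi>. \<pi> permutes {..<n} \<and> (\<pi> a, \<pi> b) \<in> winning_positions} * (n * (n - 1))"
        using card_permutations_positions[OF ab winning_positions_subset] by (auto simp: card_winning_positions)
      also have "\<dots> \<le> card ?A * (n * (n - 1))"
        using win by (intro mult_le_mono1 card_mono finA) auto
      finally have "?N * k * (n - 1) \<le> card ?A * n * (n - 1)" by (simp add: mult.assoc)
      moreover have "0 < n - 1" using ab by linarith
      ultimately show ?thesis by simp
    qed
    have Q: "((j, y), (i, x)) \<in> placements n" using P False by (auto simp: placements_iff)
    show ?thesis
    proof (cases "x \<le> y")
      case True
      show ?thesis
        using strategy_at_wins(1)[OF _ P \<open>i \<noteq> j\<close> True] by (intro pairs[OF ij \<open>i \<noteq> j\<close>]) simp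
    next
      case False
      then have "y \<le> x" by simp
      then show ?thesis
        using strategy_at_wins(2)[OF _ Q \<open>i \<noteq> j\<close>[symmetric]] \<open>i \<noteq> j\<close>
        by (intro pairs[OF ij(2,1)]) simp_all
    qed
  qed
qed

lemma values_ge_ratio: "k / n \<le> lower_value n h" "k / n \<le> upper_value n h"
proof -
  let ?\<Omega> = "{\<pi>. \<pi> permutes {..<n}}"
  have n: "1 \<le> n" using k by simp
  have \<Omega>: "finite ?\<Omega>" "?\<Omega> \<noteq> {}" using finite_permutations permutes_id by blast+
  have strat: "strategy_at ` ?\<Omega> \<subseteq> searching_strategies n h"
    using parallel_search.search_strategy[OF parallel_search_at] by (auto simp: strategy_at_def)
  have borel: "winning_set n h (strategy_at \<pi>) \<in> sets (restrict_space borel (placements n))" if "\<pi> \<in> ?\<Omega>" for \<pi>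
    using parallel_search.winning_set_search_borel[OF parallel_search_at] that by (auto simp: strategy_at_def)
  have win: "k / n * card ?\<Omega> \<le> card {\<pi> \<in> ?\<Omega>. searcher_wins h (strategy_at \<pi>) P}"
    if "P \<in> placements n" for P
  proof -
    obtain i x j y where P: "P = ((i, x), (j, y))" by (metis surj_pair)
    have "real (card ?\<Omega> * k) \<le> real (card {\<pi> \<in> ?\<Omega>. searcher_wins h (strategy_at \<pi>) P} * n)"
      unfolding of_nat_le_iff using card_winning_permutations[of i x j y] that P by simp
    then show ?thesis using n by (simp add: field_simps)
  qed
  show "k / n \<le> lower_value n h" "k / n \<le> upper_value n h"
    by (rule values_ge[OF n \<Omega> strat borel win]; assumption)+
qed

end

text \<open>The bounds on \<open>h\<close> force \<open>n \<le> 2 * k\<close>. If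
  \<open>n < 2 * k\<close>, the \<open>n - k\<close> outer positions fit into a set of
  \<open>k - 1\<close> elements. If \<open>n = 2 * k\<close>, all outer positions but
  \<open>n - 1\<close> are taken, and \<open>h - k \<ge> 1 / 2\<close> pays for that one.\<close>

lemma position_search_exists:
  fixes n k :: nat
  assumes k: "1 \<le> k" "k \<le> n" "real k \<le> h" "h < real k + 1" and h: "(real n + 1) / 2 \<le> h"
  shows "\<exists>D. position_search n k h D"
proof (cases "n < 2 * k")
  case True
  have "\<exists>B. {k..<n} \<subseteq> B \<and> B \<subseteq> {..<n} - {p} \<and> card B = k - 1" if "p < k" for p
    using that True k by (intro exists_subset_between) auto
  then obtain D where D: "\<And>p. p < k \<Longrightarrow> {k..<n} \<subseteq> D p"
    "\<And>p. p < k \<Longrightarrow> D p \<subseteq> {..<n} - {p}" "\<And>p. p < k \<Longrightarrow> card (D p) = k - 1" by metis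
  have "card ({k..<n} - D p) / 2 \<le> h - k" if "p < k" for p
  proof -
    have empty: "{k..<n} - D p = {}" using D(1)[OF that] by blast
    show ?thesis unfolding empty using k by simp
  qed
  then have "position_search n k h D" using D(2,3) k by unfold_locales
  then show ?thesis by blast
next
  case False
  have "real n < real (2 * k + 1)" using h k by (simp add: field_simps)
  then have "n \<le> 2 * k" by (simp only: of_nat_less_iff)
  with False have n: "n = 2 * k" by simp
  have "{k..<n} - {k..<n - 1} = {n - 1}" using n k by auto
  then have "position_search n k h (\<lambda>_. {k..<n - 1})"
    using k n h by unfold_locales auto
  then show ?thesis by blast
qed

theorem theorem2p26:
  fixes n :: nat and h :: real
  assumes "n \<ge> 1" and "h > 0"
  shows "((real n + 1) / 2 \<le> h \<and> h \<le> real n \<longrightarrow> has_value n h (real_of_int \<lfloor>h\<rfloor> / real n))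
    \<and> (\<forall>v. has_value n h v \<longrightarrow> v \<le> real_of_int \<lfloor>h\<rfloor> / real n)
    \<and> lower_value n h \<le> real_of_int \<lfloor>h\<rfloor> / real n
    \<and> upper_value n h \<le> real_of_int \<lfloor>h\<rfloor> / real n
    \<and> uniform_bottom_hiding n \<in> hiding_strategies n
    \<and> (\<forall>\<sigma> \<in> searching_strategies n h.
         winning_set n h \<sigma> \<in> sets (uniform_bottom_hiding n) \<and>
         measure (uniform_bottom_hiding n) (winning_set n h \<sigma>) \<le> real_of_int \<lfloor>h\<rfloor> / real n)"
proof -
  have "has_value n h (\<lfloor>h\<rfloor> / n)" if h: "(real n + 1) / 2 \<le> h" "h \<le> real n"
  proof -
    define k where "k = nat \<lfloor>h\<rfloor>"
    have "1 \<le> h" using h \<open>n \<ge> 1\<close> by (simp add: field_simps)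
    then have k: "real k = \<lfloor>h\<rfloor>" "1 \<le> k" unfolding k_def by (simp_all add: le_nat_iff le_floor_iff)
    moreover have "k \<le> n" "real k \<le> h" "h < real k + 1" using k h by linarith+
    ultimately obtain D where "position_search n k h D" using position_search_exists h by blast
    note position_search.values_ge_ratio[OF this]
    then show ?thesis
      using lower_value_le[OF assms] upper_value_le[OF assms] k by (simp add: has_value_def)
  qed
  then show ?thesis
    using lower_value_le[OF assms] upper_value_le[OF assms] uniform_bottom_hiding_in[OF assms(1)]
      uniform_bottom_hiding_bound[OF assms] by (auto simp: has_value_def)
qed

end
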